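(* Let $K$ be a non-trivial semiring and let $n\ge1$ be a fixed integer. If the map $\mathcal P_n\to\mathcal M_{2^n}(K):a\mapsto\overline a$ is a morphism (i.e. $\overline{ab}=\overline a\,\overline b$ for all $a,b\in\mathcal P_n$), then $K$ is (additively) idempotent, i.e. $1+1=1$ in $K$.
   Context: **Partition monoid.** $[n]=\{1,\ldots,n\}$, and $A'$, $A''$ denote disjoint copies of $A\subseteq[n]$. $\mathcal P_n$ is the set of all set partitions of $[n]\cup[n]'$; the elements of $a\in\mathcal P_n$ are called $a$-blocks, and $a$ is identified with any graph whose connected components are its blocks. For $a,b\in\mathcal P_n$, the product graph $\Pi(a,b)$ has vertex set $[n]\cup[n]''\cup[n]'$ and edges those of $a$ (lower vertices $x'$ renamed $x''$) and of $b$ (upper vertices $x$ renamed $x''$); $ab\in\mathcal P_n$ is the partition in which $x,y\in[n]\cup[n]'$ are in the same block iff they are in the same connected component of $\Pi(a,b)$. **Matrices.** A semiring $(K,+,\cdot,0,1)$ has $(K,+,0)$ a commutative monoid, $(K,\cdot,1)$ a monoid, multiplication distributing over addition, and $0$ a multiplicative zero; non-trivial means $0\ne1$. $\mathcal M_{2^n}(K)$ is the monoid of $2^n\times2^n$ matrices over $K$, with rows and columns indexed by subsets of $[n]$. For $a\in\mathcal P_n$ and $X,Y\subseteq[n]$, $\overline a_{X,Y}=1$ if $X\cup Y'$ is a (possibly empty) union of $a$-blocks, and $\overline a_{X,Y}=0$ otherwise. *)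

theory Defs
  imports "HOL-Analysis.Finite_Cartesian_Product" "HOL-Library.Disjoint_Sets"
begin

text \<open>
  The set \<open>[n]\<close> is the universe of a type \<open>'n\<close> of class \<open>finite\<close>, so that \<open>n = CARD('n)\<close>,
  and \<open>n \<ge> 1\<close> because types are non-empty.  \<open>Upper x\<close> and \<open>Lower x\<close> stand for
  \<open>x \<in> [n]\<close> and \<open>x' \<in> [n]'\<close>.
\<close>

datatype 'n vertex = Upper 'n | Lower 'n

definition partitions :: "'n vertex set set set" where
  "partitions = {a. partition_on UNIV a}"

text \<open>
  Vertices of the product graph: \<open>Top x\<close>, \<open>Mid x\<close>, \<open>Bot x\<close> stand for \<open>x\<close>, \<open>x''\<close>, \<open>x'\<close>.
\<close>

datatype 'n pvertex = Top 'n | Mid 'n | Bot 'n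

primrec lower_to_mid :: "'n vertex \<Rightarrow> 'n pvertex" where
  "lower_to_mid (Upper x) = Top x"
| "lower_to_mid (Lower x) = Mid x"

primrec upper_to_mid :: "'n vertex \<Rightarrow> 'n pvertex" where
  "upper_to_mid (Upper x) = Mid x"
| "upper_to_mid (Lower x) = Bot x"

primrec outer :: "'n vertex \<Rightarrow> 'n pvertex" where
  "outer (Upper x) = Top x"
| "outer (Lower x) = Bot x"

text \<open>
  Of the graphs whose connected components are the blocks of \<open>a\<close>, we take the one in which
  every block is complete (with loops); its edge relation is symmetric.
\<close>

definition edges :: "'n vertex set set \<Rightarrow> ('n vertex \<times> 'n vertex) set" where
  "edges a = {(x, y). \<exists>B\<in>a. x \<in> B \<and> y \<in> B}"

definition product_graph ::
  "'n vertex set set \<Rightarrow> 'n vertex set set \<Rightarrow> ('n pvertex \<times> 'n pvertex) set" where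
  "product_graph a b =
     map_prod lower_to_mid lower_to_mid ` edges a \<union> map_prod upper_to_mid upper_to_mid ` edges b"

definition pprod :: "'n vertex set set \<Rightarrow> 'n vertex set set \<Rightarrow> 'n vertex set set"
    (infixl "\<odot>" 70) where
  "a \<odot> b = UNIV // {(x, y). (outer x, outer y) \<in> (product_graph a b)\<^sup>*}"

lemma pprod_in_partitions: "a \<odot> b \<in> partitions"
proof -
  let ?G = "product_graph a b"
  have "sym ?G"
    by (auto simp: sym_def product_graph_def edges_def image_iff map_prod_def) blast+
  then have "sym (?G\<^sup>*)"
    by (rule sym_rtrancl)
  then have "equiv UNIV {(x, y). (outer x, outer y) \<in> ?G\<^sup>*}"
    by (intro equivI) (auto simp: refl_on_def intro: symI transI dest: symD)
  then show ?thesis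
    unfolding partitions_def pprod_def by (simp add: partition_on_quotient)
qed

text \<open>
  Rows and columns are indexed by the subsets of \<open>[n]\<close>, i.e. by the type \<open>'n set\<close>.
\<close>

definition matrix_of :: "'n::finite vertex set set \<Rightarrow> 'k::semiring_1 ^ ('n set) ^ ('n set)" where
  "matrix_of a = (\<chi> X Y. if \<exists>C\<subseteq>a. Upper ` X \<union> Lower ` Y = \<Union>C then 1 else 0)"

end

theory Submission imports Defs begin

text \<open>
  The entry of \<open>matrix_of a ** matrix_of b\<close> at \<open>({}, {})\<close> counts, in \<open>'k\<close>, the sets \<open>Z\<close> for
  which \<open>Z\<close> (as a set of lower vertices) is a union of blocks of \<open>a\<close> and \<open>Z\<close> (as a set of upper
  vertices) is a union of blocks of \<open>b\<close>. These are the unions of components of the product graph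
  that stay inside its middle row, so each component trapped there doubles the count,
  whereas the product partition does not see such components: its entry at
  \<open>({}, {})\<close> is \<open>1\<close> like that of any partition.

  It therefore suffices to trap exactly one component. Take \<open>a = b\<close> to be the partition with the
  two blocks \<open>range Upper\<close> and \<open>range Lower\<close>: the middle row is then a single component, and the
  count is over \<open>Z = {}\<close> and \<open>Z = UNIV\<close>, two different sets as types are non-empty. The morphism
  property at \<open>({}, {})\<close> then reads \<open>1 = 1 + 1\<close>.
\<close>

definition row_partition :: "'n vertex set set" where
  "row_partition = {range Upper, range Lower}"

lemma row_partition_in_partitions: "row_partition \<in> partitions"
proof -
  have "v \<in> range Upper \<union> range Lower" for v :: "'n vertex"
    by (cases v) auto
  then show ?thesis
    by (auto simp: partitions_def row_partition_def partition_on_def disjoint_def)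
qed

lemma matrix_of_empty_empty: "matrix_of a $ {} $ {} = 1"
  by (auto simp: matrix_of_def)

lemma union_of_row_partition_iff:
  "(\<exists>C\<subseteq>row_partition. Upper ` X \<union> Lower ` Y = \<Union>C) \<longleftrightarrow> X \<in> {{}, UNIV} \<and> Y \<in> {{}, UNIV}"
proof
  assume "\<exists>C\<subseteq>row_partition. Upper ` X \<union> Lower ` Y = \<Union>C"
  then obtain C where C: "C \<subseteq> row_partition" and eq: "Upper ` X \<union> Lower ` Y = \<Union>C"
    by blast
  have X: "x \<in> X \<longleftrightarrow> range Upper \<in> C" for x
  proof -
    have "x \<in> X \<longleftrightarrow> Upper x \<in> Upper ` X \<union> Lower ` Y"
      by auto
    also have "\<dots> \<longleftrightarrow> range Upper \<in> C"
      unfolding eq using C by (auto simp: row_partition_def)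
    finally show ?thesis .
  qed
  have Y: "y \<in> Y \<longleftrightarrow> range Lower \<in> C" for y
  proof -
    have "y \<in> Y \<longleftrightarrow> Lower y \<in> Upper ` X \<union> Lower ` Y"
      by auto
    also have "\<dots> \<longleftrightarrow> range Lower \<in> C"
      unfolding eq using C by (auto simp: row_partition_def)
    finally show ?thesis .
  qed
  show "X \<in> {{}, UNIV} \<and> Y \<in> {{}, UNIV}"
    using X Y by blast
next
  assume *: "X \<in> {{}, UNIV} \<and> Y \<in> {{}, UNIV}"
  let ?C = "(if X = {} then {} else {range Upper}) \<union> (if Y = {} then {} else {range Lower})"
  have "?C \<subseteq> row_partition" "Upper ` X \<union> Lower ` Y = \<Union>?C"
    using * by (auto simp: row_partition_def)
  then show "\<exists>C\<subseteq>row_partition. Upper ` X \<union> Lower ` Y = \<Union>C"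
    by blast
qed

lemma matrix_of_row_partition:
  "matrix_of row_partition $ X $ Y = (if X \<in> {{}, UNIV} \<and> Y \<in> {{}, UNIV} then 1 else 0)"
  by (simp only: matrix_of_def vec_lambda_beta union_of_row_partition_iff)

lemma matrix_of_row_partition_square:
  "(matrix_of row_partition ** matrix_of row_partition :: 'k::semiring_1 ^ ('n::finite set) ^ ('n set))
     $ {} $ {} = 1 + 1"
proof -
  let ?M = "matrix_of row_partition :: 'k ^ ('n set) ^ ('n set)"
  have "(?M ** ?M) $ {} $ {} = (\<Sum>Z\<in>(UNIV :: 'n set set). if Z \<in> {{}, UNIV} then 1 else 0)"
    unfolding matrix_matrix_mult_def vec_lambda_beta
    by (rule sum.cong) (simp_all add: matrix_of_row_partition)
  also have "\<dots> = (\<Sum>Z\<in>{{}, UNIV :: 'n set}. 1)"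
    by (rule sum.mono_neutral_cong_right) auto
  also have "\<dots> = 1 + 1"
    by simp
  finally show ?thesis .
qed

theorem mainTheorem10:
  assumes "\<forall>a\<in>partitions. \<forall>b\<in>partitions.
    (matrix_of (a \<odot> b) :: 'k::semiring_1 ^ ('n::finite set) ^ ('n set)) = matrix_of a ** matrix_of b"
  shows "(1::'k) + 1 = 1"
proof -
  let ?r = "row_partition :: 'n vertex set set"
  have "(1::'k) + 1 = (matrix_of ?r ** matrix_of ?r) $ {} $ {}"
    by (simp only: matrix_of_row_partition_square)
  also have "\<dots> = matrix_of (?r \<odot> ?r) $ {} $ {}"
    using assms row_partition_in_partitions by metis
  also have "\<dots> = 1"
    by (rule matrix_of_empty_empty)
  finally show ?thesis .
qed

end
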